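(* Let $A \in \mathbb{Z}^{n \times r}$ (satisfying the standing assumptions in the context) and let $\overline{A} \in \mathbb{Z}^{n \times s}$ consist of the first $s$ columns of $A$. Suppose that $\overline{A}$ is a facial submatrix of $A$. Let $\mathcal{M}_A$ have rational maximum likelihood estimator $\Psi$ given by the Horn pair $(B,h)$, where $B \in \mathbb{Z}^{d \times r}$ and $h \in (\mathbb{C}^* )^r$. Let $\overline{B}$ denote the submatrix consisting of the first $s$ columns of $B$ and let $\bar{h} = (h_1,\dots,h_s)$. Then $\mathcal{M}_{\overline{A}}$ has rational maximum likelihood estimator $\overline{\Psi}$ given by the Horn pair $(\overline{B},\bar{h})$.
   Context: Log-linear models: for an integer matrix $A$ with $r$ columns, $\mathcal{M}_A := \{p \in \Delta_{r-1} \mid \log p \in \mathrm{rowspan}(A)\}$, where $\Delta_{r-1} = \{x\in\mathbb{R}^r \mid x_i>0,\ \sum_i x_i = 1\}$ and $\log$ is taken coordinatewise. Standing assumptions on $A$: $\mathbf{1} = (1,\dots,1) \in \mathrm{rowspan}(A)$; the polytope $P_A = \mathrm{conv}(\mathbf{a}_1,\dots,\mathbf{a}_r)$, the convex hull of the columns of $A$, has exactly $n$ facets $F_1,\dots,F_n$, and the entry $a_{ij}$ of $A$ equals the lattice distance between the column $\mathbf{a}_j$ and the facet $F_i$ (so $a_{ij}=0$ if $\mathbf{a}_j \in F_i$, and $a_{ij}$ is an integer $\geq 1$ otherwise). Facial submatrix: $\overline{A}$, a matrix whose columns are a subset of the columns of $A$, is a facial submatrix of $A$ if $P_{\overline{A}}$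 is a (nonempty) face of $P_A$ and $\overline{A}$ consists of exactly the columns of $A$ lying on that face. Maximum likelihood: for $u \in \mathbb{R}_{\ge 0}^r$, the maximum likelihood estimate for $u$ in a model $\mathcal{M}\subset\Delta_{r-1}$ is the $\hat p \in \mathcal{M}$ maximizing $\prod_{i=1}^r p_i^{u_i}$ over $\mathcal{M}$; the map $u\mapsto\hat p$ is the maximum likelihood estimator. Horn pairs: a pair $(B,h)$ with $B = (b_{ij}) \in \mathbb{Z}^{d\times r}$ having all column sums zero and $h \in (\mathbb{C}^* )^r$ is the Horn pair defining the Horn map $\Psi$ with coordinate functions \[ \Psi_k(u_1,\dots,u_r) = h_k \prod_{i=1}^d \Big( \sum_{j=1}^r b_{ij} u_j \Big)^{b_{ik}}, \qquad k=1,\dots,r, \] where a factor with exponent $b_{ik}=0$ is identically $1$. The maximum likelihood estimator of $\mathcal{M}$ is given by the Horn pair $(B,h)$ if, for generic $u$, the maximum likelihood estimate for $u$ in $\mathcal{M}$ is $\Psi(u)$. *)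

theory Defs
  imports "HOL-Analysis.Analysis"
begin

text \<open>
  Matrices are functions \<open>row \<Rightarrow> column \<Rightarrow> entry\<close>. Columns are indexed by natural numbers from 0,
  so vectors in \<open>\<real>\<^sup>r\<close> are elements of \<open>{..<r} \<rightarrow>\<^sub>E UNIV\<close>. All notions depend on the number of
  columns explicitly and only look at the columns \<open>j < r\<close>; hence the submatrix consisting of the
  first \<open>s\<close> columns is the same function used with \<open>s\<close> in place of \<open>r\<close>.
  The rows of \<open>A\<close> are indexed by a finite type, so that its columns are points of \<open>real ^ 'n\<close>.
\<close>

definition column :: "('n \<Rightarrow> nat \<Rightarrow> int) \<Rightarrow> nat \<Rightarrow> real ^ 'n::finite"
  where "column A j = (\<chi> i. real_of_int (A i j))"

definition column_polytope :: "('n \<Rightarrow> nat \<Rightarrow> int) \<Rightarrow> nat set \<Rightarrow> (real ^ 'n::finite) set"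
  where "column_polytope A J = convex hull (column A ` J)"

definition rowspan :: "nat \<Rightarrow> ('n::finite \<Rightarrow> nat \<Rightarrow> int) \<Rightarrow> (nat \<Rightarrow> real) set"
  where "rowspan r A =
    {v. \<exists>c :: 'n \<Rightarrow> real. v = (\<lambda>j\<in>{..<r}. \<Sum>i\<in>UNIV. c i * real_of_int (A i j))}"

definition open_simplex :: "nat \<Rightarrow> (nat \<Rightarrow> real) set"
  where "open_simplex r = {p \<in> {..<r} \<rightarrow>\<^sub>E {0<..}. (\<Sum>j<r. p j) = 1}"

definition log_linear_model :: "nat \<Rightarrow> ('n::finite \<Rightarrow> nat \<Rightarrow> int) \<Rightarrow> (nat \<Rightarrow> real) set"
  where "log_linear_model r A =
    {p \<in> open_simplex r. (\<lambda>j\<in>{..<r}. ln (p j)) \<in> rowspan r A}"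

text \<open>
  The lattice distance to a facet \<open>F\<close> of a lattice polytope \<open>P\<close> in \<open>real ^ 'n\<close> is the affine
  function on the affine hull of \<open>P\<close> that vanishes on \<open>F\<close>, is nonnegative on \<open>P\<close> and is primitive
  for the lattice of integer points of the affine hull: its set of values on these points is
  exactly the set of integers. \<open>P\<close> need not be full-dimensional; the conditions determine the
  function on the affine hull of \<open>P\<close> only.
\<close>

definition lattice_distance_function ::
    "(real ^ 'n::finite) set \<Rightarrow> (real ^ 'n) set \<Rightarrow> (real ^ 'n \<Rightarrow> real) \<Rightarrow> bool"
  where "lattice_distance_function P F l \<longleftrightarrow>
    (\<exists>c b. l = (\<lambda>x. c \<bullet> x + b)) \<and>
    (\<forall>x\<in>F. l x = 0) \<and> (\<forall>x\<in>P. l x \<ge> 0) \<and>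
    l ` {x \<in> affine hull P. \<forall>i. x $ i \<in> \<int>} = \<int>"

text \<open>The bijection \<open>F\<close> expresses that the polytope has exactly \<open>CARD('n)\<close> facets, one per row.\<close>

definition lattice_distance_matrix :: "nat \<Rightarrow> ('n::finite \<Rightarrow> nat \<Rightarrow> int) \<Rightarrow> bool"
  where "lattice_distance_matrix r A \<longleftrightarrow>
    (\<exists>F. bij_betw F (UNIV :: 'n set) {G. G facet_of column_polytope A {..<r}} \<and>
      (\<forall>i. \<exists>l. lattice_distance_function (column_polytope A {..<r}) (F i) l \<and>
        (\<forall>j<r. real_of_int (A i j) = l (column A j))))"

definition facial_submatrix :: "nat \<Rightarrow> ('n::finite \<Rightarrow> nat \<Rightarrow> int) \<Rightarrow> nat set \<Rightarrow> bool"
  where "facial_submatrix r A J \<longleftrightarrow>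
    J \<subseteq> {..<r} \<and>
    column_polytope A J \<noteq> {} \<and> column_polytope A J face_of column_polytope A {..<r} \<and>
    J = {j. j < r \<and> column A j \<in> column_polytope A J}"

definition likelihood :: "nat \<Rightarrow> (nat \<Rightarrow> real) \<Rightarrow> (nat \<Rightarrow> real) \<Rightarrow> real"
  where "likelihood r u p = (\<Prod>j<r. p j powr u j)"

definition is_mle ::
    "nat \<Rightarrow> (nat \<Rightarrow> real) set \<Rightarrow> (nat \<Rightarrow> real) \<Rightarrow> (nat \<Rightarrow> real) \<Rightarrow> bool"
  where "is_mle r M u p \<longleftrightarrow>
    p \<in> M \<and> (\<forall>q\<in>M. q \<noteq> p \<longrightarrow> likelihood r u q < likelihood r u p)"

definition horn_pair :: "nat \<Rightarrow> nat \<Rightarrow> (nat \<Rightarrow> nat \<Rightarrow> int) \<Rightarrow> (nat \<Rightarrow> complex) \<Rightarrow> bool"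
  where "horn_pair d r B h \<longleftrightarrow>
    (\<forall>j<r. (\<Sum>i<d. B i j) = 0) \<and> (\<forall>j<r. h j \<noteq> 0)"

text \<open>Note that \<open>x powi 0 = 1\<close> also for \<open>x = 0\<close>, so factors with exponent 0 are identically 1.\<close>

definition horn_map ::
    "nat \<Rightarrow> nat \<Rightarrow> (nat \<Rightarrow> nat \<Rightarrow> int) \<Rightarrow> (nat \<Rightarrow> complex) \<Rightarrow> (nat \<Rightarrow> real) \<Rightarrow> nat \<Rightarrow> complex"
  where "horn_map d r B h u k =
    h k * (\<Prod>i<d. (\<Sum>j<r. of_int (B i j) * complex_of_real (u j)) powi B i k)"

inductive polynomial_fun :: "nat \<Rightarrow> ((nat \<Rightarrow> real) \<Rightarrow> real) \<Rightarrow> bool" for r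
  where
    const: "polynomial_fun r (\<lambda>u. c)"
  | coord: "j < r \<Longrightarrow> polynomial_fun r (\<lambda>u. u j)"
  | add: "polynomial_fun r f \<Longrightarrow> polynomial_fun r g \<Longrightarrow> polynomial_fun r (\<lambda>u. f u + g u)"
  | mult: "polynomial_fun r f \<Longrightarrow> polynomial_fun r g \<Longrightarrow> polynomial_fun r (\<lambda>u. f u * g u)"

text \<open>
  A property holds for generic data \<open>u\<close> in the nonnegative orthant if it holds off a proper
  Zariski closed subset of \<open>\<real>\<^sup>r\<close>. Such a subset lies in the zero set of a single nonzero polynomial.
\<close>

definition generic_data :: "nat \<Rightarrow> ((nat \<Rightarrow> real) \<Rightarrow> bool) \<Rightarrow> bool"
  where "generic_data r Q \<longleftrightarrow>
    (\<exists>f. polynomial_fun r f \<and> (\<exists>x. f x \<noteq> 0) \<and>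
      (\<forall>u \<in> {..<r} \<rightarrow>\<^sub>E {0..}. f u \<noteq> 0 \<longrightarrow> Q u))"

definition mle_given_by_horn_pair ::
    "nat \<Rightarrow> (nat \<Rightarrow> real) set \<Rightarrow> nat \<Rightarrow> (nat \<Rightarrow> nat \<Rightarrow> int) \<Rightarrow> (nat \<Rightarrow> complex) \<Rightarrow> bool"
  where "mle_given_by_horn_pair r M d B h \<longleftrightarrow>
    horn_pair d r B h \<and>
    generic_data r (\<lambda>u. \<exists>p. is_mle r M u p \<and>
      (\<forall>k<r. complex_of_real (p k) = horn_map d r B h u k))"

end

theory Submission
  imports Defs
begin

text \<open>
  For data \<open>u\<close> on the face, feed the maximum likelihood estimator of the big model with
  \<open>u\<^sub>\<epsilon> = (u, \<epsilon> w)\<close> for a fixed \<open>w \<ge> 0\<close> and let \<open>\<epsilon>\<close> tend to 0 from above. If \<open>k < s\<close> and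
  \<open>b\<^sub>i\<^sub>k \<noteq> 0\<close>, then the \<open>i\<close>-th linear form of the Horn map does not vanish identically on the face,
  so the first \<open>s\<close> coordinates of the estimate converge, for generic \<open>u\<close>, to the truncated Horn
  map \<open>\<psi>\<close> at \<open>u\<close>, and \<open>\<psi> > 0\<close>. As probabilities are at most 1, dropping the last coordinates can
  only increase the likelihood. Every point of the model of the face is a limit of points of the
  big model, obtained by tilting with a functional that exposes the face. Hence the likelihood of
  \<open>\<psi>\<close> is at least the maximum over the model of the face. Rescaling \<open>\<psi>\<close> to total mass 1 yields a
  point of that model, which forces the total mass of \<open>\<psi>\<close> to be 1.
\<close>

subsection \<open>Nonvanishing of polynomial functions\<close>

lemma polynomial_fun_cong:
  assumes "polynomial_fun r f" and "\<And>j. j < r \<Longrightarrow> x j = y j"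
  shows "f x = f y"
  using assms by induction simp_all

lemma polynomial_fun_sum:
  assumes "finite I" and "\<And>i. i \<in> I \<Longrightarrow> polynomial_fun r (f i)"
  shows "polynomial_fun r (\<lambda>u. \<Sum>i\<in>I. f i u)"
  using assms by (induction I rule: finite_induct) (auto intro: polynomial_fun.intros)

text \<open>Reduces questions of nonvanishing in several variables to a univariate polynomial, which
  has finitely many roots unless it is zero.\<close>

lemma polynomial_fun_along_line:
  assumes "polynomial_fun r f"
  shows "\<exists>P. \<forall>t. f (\<lambda>j. x j + t * y j) = poly P t"
  using assms
proof induction
  case (const c)
  then show ?case by (intro exI[of _ "[:c:]"]) simp
next
  case (coord j)
  then show ?case by (intro exI[of _ "[:x j, y j:]"]) simp
next
  case (add f g)
  then show ?case by (metis poly_add)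
next
  case (mult f g)
  then show ?case by (metis poly_mult)
qed

text \<open>One nonzero value, at any parameter \<open>t0\<close>, leaves only finitely many zeros
  on the line, and a small enough punctured neighbourhood of \<open>a\<close> avoids them
  all.\<close>

lemma polynomial_fun_eventually_nonzero_on_line:
  assumes "polynomial_fun r f" and "f (\<lambda>j. x j + t0 * y j) \<noteq> 0"
  shows "eventually (\<lambda>t. f (\<lambda>j. x j + t * y j) \<noteq> 0) (at a within S)"
proof -
  obtain P where P: "\<And>t. f (\<lambda>j. x j + t * y j) = poly P t"
    using polynomial_fun_along_line[OF assms(1)] by blast
  have "finite {t. poly P t = 0}"
    using assms(2) P by (intro poly_roots_finite) auto
  then have "eventually (\<lambda>t. t \<notin> {t. poly P t = 0}) (at a)"
    using islimpt_finite islimpt_iff_eventually by blast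
  then show ?thesis
    unfolding P mem_Collect_eq by (rule filter_leD[OF at_le[OF subset_UNIV]])
qed

text \<open>On the line from \<open>x\<close> to \<open>y\<close>, \<open>f\<close> is nonzero at
  parameter 0 and \<open>g\<close> at parameter 1, so both are nonzero at all parameters close to
  but different from 0.\<close>

lemma polynomial_fun_nonzero_mult:
  assumes "polynomial_fun r f" "f x \<noteq> 0" "polynomial_fun r g" "g y \<noteq> 0"
  shows "\<exists>z. f z * g z \<noteq> 0"
proof -
  let ?l = "\<lambda>t j. x j + t * (y j - x j)"
  have "eventually (\<lambda>t. f (?l t) \<noteq> 0) (at 0)"
    using assms(1,2) by (intro polynomial_fun_eventually_nonzero_on_line[where ?t0.0 = 0]) auto
  moreover have "eventually (\<lambda>t. g (?l t) \<noteq> 0) (at 0)"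
    using assms(3,4) by (intro polynomial_fun_eventually_nonzero_on_line[where ?t0.0 = 1]) auto
  ultimately have "eventually (\<lambda>t. f (?l t) * g (?l t) \<noteq> 0) (at 0)"
    by eventually_elim simp
  then show ?thesis
    using eventually_happens' [OF trivial_limit_at] by blast
qed

lemma polynomial_fun_nonzero_prod:
  assumes "finite I" and "\<And>i. i \<in> I \<Longrightarrow> polynomial_fun r (f i) \<and> (\<exists>x. f i x \<noteq> 0)"
  shows "polynomial_fun r (\<lambda>u. \<Prod>i\<in>I. f i u) \<and> (\<exists>x. (\<Prod>i\<in>I. f i x) \<noteq> 0)"
  using assms
proof (induction I rule: finite_induct)
  case empty
  then show ?case by (auto intro: polynomial_fun.intros)
next
  case (insert i I)
  then obtain x y where "f i x \<noteq> 0" "(\<Prod>i\<in>I. f i y) \<noteq> 0" by blast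
  with insert show ?case
    using polynomial_fun_nonzero_mult[of r "f i" x "\<lambda>u. \<Prod>i\<in>I. f i u" y]
    by (auto intro: polynomial_fun.mult)
qed

text \<open>Move from the all-ones point slightly towards \<open>x\<close>: the first
  \<open>r\<close> coordinates stay positive, while \<open>f\<close> has only finitely many zeros on
  this line.\<close>

lemma polynomial_fun_nonzero_nonneg:
  assumes "polynomial_fun r f" and "f x \<noteq> 0"
  obtains y where "f y \<noteq> 0" "\<And>j. y j \<ge> 0"
proof -
  let ?l = "\<lambda>t j. 1 + t * (x j - 1)"
  have "eventually (\<lambda>t. f (?l t) \<noteq> 0) (at_right 0)"
    using assms by (intro polynomial_fun_eventually_nonzero_on_line[where ?t0.0 = 1]) auto
  moreover have "eventually (\<lambda>t. ?l t j > 0) (at_right 0)" for j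
  proof -
    have "((\<lambda>t. ?l t j) \<longlongrightarrow> 1 + 0 * (x j - 1)) (at_right 0)"
      by (intro tendsto_intros)
    then show ?thesis by (rule order_tendstoD) simp
  qed
  then have "eventually (\<lambda>t. \<forall>j\<in>{..<r}. ?l t j > 0) (at_right 0)"
    by (intro eventually_ball_finite) auto
  ultimately have "eventually (\<lambda>t. f (?l t) \<noteq> 0 \<and> (\<forall>j\<in>{..<r}. ?l t j > 0)) (at_right 0)"
    by eventually_elim simp
  then obtain t where t: "f (?l t) \<noteq> 0" "\<forall>j\<in>{..<r}. ?l t j > 0"
    using eventually_happens' [OF trivial_limit_at_right_real] by blast
  \<comment> \<open>The value of \<open>f\<close> does not depend on coordinates from
    \<open>r\<close> on; setting them to 0 makes every coordinate nonnegative.\<close>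
  let ?y = "\<lambda>j. if j < r then ?l t j else 0"
  have "f ?y = f (?l t)"
    using assms(1) by (rule polynomial_fun_cong) simp
  with t that[of ?y] show thesis by (simp add: less_imp_le)
qed

lemma polynomial_fun_fix_coords:
  assumes "polynomial_fun r f"
  shows "polynomial_fun s (\<lambda>u. f (\<lambda>j. if j < s then u j else w j))"
  using assms
proof induction
  case (coord j)
  then show ?case by (cases "j < s") (auto intro: polynomial_fun.intros)
qed (auto intro: polynomial_fun.intros)

subsection \<open>Log-linear models\<close>

lemma sum_mult_column: "(\<Sum>i\<in>UNIV. c i * real_of_int (A i j)) = (\<chi> i. c i) \<bullet> column A j"
  by (simp add: inner_vec_def column_def)

lemma rowspan_iff:
  "(\<lambda>j\<in>{..<r}. v j) \<in> rowspan r A \<longleftrightarrow> (\<exists>c. \<forall>j<r. v j = c \<bullet> column A j)"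
proof
  assume "(\<lambda>j\<in>{..<r}. v j) \<in> rowspan r A"
  then obtain c where "(\<lambda>j\<in>{..<r}. v j) = (\<lambda>j\<in>{..<r}. (\<chi> i. c i) \<bullet> column A j)"
    by (auto simp: rowspan_def sum_mult_column)
  then have "v j = (\<chi> i. c i) \<bullet> column A j" if "j < r" for j
    using that by (auto dest: fun_cong[of _ _ j])
  then show "\<exists>c. \<forall>j<r. v j = c \<bullet> column A j" by blast
next
  assume "\<exists>c. \<forall>j<r. v j = c \<bullet> column A j"
  then obtain c where "\<forall>j<r. v j = c \<bullet> column A j" by blast
  then show "(\<lambda>j\<in>{..<r}. v j) \<in> rowspan r A"
    unfolding rowspan_def mem_Collect_eq sum_mult_column
    by (intro exI[of _ "\<lambda>i. c $ i"]) auto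
qed

lemma log_linear_model_iff:
  "p \<in> log_linear_model r A \<longleftrightarrow>
    p \<in> open_simplex r \<and> (\<exists>c. \<forall>j<r. ln (p j) = c \<bullet> column A j)"
  unfolding log_linear_model_def rowspan_iff by blast

lemma open_simplexD:
  assumes "p \<in> open_simplex r"
  shows "j < r \<Longrightarrow> p j > 0" "(\<Sum>j<r. p j) = 1"
  using assms by (auto simp: open_simplex_def PiE_iff)

lemma open_simplex_le_1:
  assumes "p \<in> open_simplex r" "j < r"
  shows "p j \<le> 1"
proof -
  have "p j \<le> (\<Sum>j<r. p j)"
    using assms(2) less_imp_le[OF open_simplexD(1)[OF assms(1)]]
    by (intro member_le_sum) auto
  then show ?thesis using open_simplexD(2)[OF assms(1)] by simp
qed

lemma open_simplex_eqI:
  assumes "p \<in> open_simplex r" "q \<in> open_simplex r" "\<And>j. j < r \<Longrightarrow> p j = q j"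
  shows "p = q"
  using assms by (auto simp: open_simplex_def intro: PiE_ext)

text \<open>Division by the total mass \<open>?Z\<close> subtracts the constant \<open>ln ?Z\<close>
  from all logarithms. Since \<open>e\<close> takes the value 1 on every column, the coefficient
  vector absorbs this constant.\<close>

lemma log_linear_model_normalize:
  assumes ones: "\<And>j. j < r \<Longrightarrow> e \<bullet> column A j = 1" and "r > 0"
  shows "(\<lambda>j\<in>{..<r}. exp (c \<bullet> column A j) / (\<Sum>k<r. exp (c \<bullet> column A k)))
    \<in> log_linear_model r A"
proof -
  let ?Z = "\<Sum>k<r. exp (c \<bullet> column A k)"
  have Z: "?Z > 0" using \<open>r > 0\<close> by (intro sum_pos) auto
  have "ln (exp (c \<bullet> column A j) / ?Z) = (c - ln ?Z *\<^sub>R e) \<bullet> column A j" if "j < r" for j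
    using that Z ones[OF that] by (simp add: ln_div inner_diff_left)
  then have "\<exists>c'. \<forall>j<r. ln (exp (c \<bullet> column A j) / ?Z) = c' \<bullet> column A j" by blast
  then show ?thesis
    unfolding log_linear_model_iff open_simplex_def
    using Z by (auto simp flip: sum_divide_distrib)
qed

section \<open>Likelihood and uniqueness of the maximizer\<close>

lemma likelihood_eq_exp:
  assumes "\<And>j. j < r \<Longrightarrow> p j > 0"
  shows "likelihood r u p = exp (\<Sum>j<r. u j * ln (p j))"
proof -
  have "likelihood r u p = (\<Prod>j<r. exp (u j * ln (p j)))"
    unfolding likelihood_def using assms by (intro prod.cong) (force simp: powr_def)+
  then show ?thesis by (simp add: exp_sum)
qed

text \<open>The normalized geometric mean of two distinct maximizers would have larger likelihood.\<close>

lemma is_mle_if_maximal: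
  assumes ones: "\<And>j. j < r \<Longrightarrow> e \<bullet> column A j = 1"
    and u: "\<And>j. j < r \<Longrightarrow> u j > 0"
    and p: "p \<in> log_linear_model r A"
    and max: "\<And>q. q \<in> log_linear_model r A \<Longrightarrow> likelihood r u q \<le> likelihood r u p"
  shows "is_mle r (log_linear_model r A) u p"
proof -
  have "likelihood r u q < likelihood r u p" if q: "q \<in> log_linear_model r A" and "q \<noteq> p" for q
  proof (rule ccontr)
    assume "\<not> ?thesis"
    with max[OF q] have eq: "likelihood r u q = likelihood r u p" by simp
    from p obtain c where c: "\<And>j. j < r \<Longrightarrow> ln (p j) = c \<bullet> column A j"
      and ps: "p \<in> open_simplex r" by (auto simp: log_linear_model_iff)
    from q obtain c' where c': "\<And>j. j < r \<Longrightarrow> ln (q j) = c' \<bullet> column A j"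
      and qs: "q \<in> open_simplex r" by (auto simp: log_linear_model_iff)
    note pD = open_simplexD[OF ps] and qD = open_simplexD[OF qs]
    obtain k where k: "k < r" "q k \<noteq> p k"
      using open_simplex_eqI[OF qs ps] \<open>q \<noteq> p\<close> by blast
    \<comment> \<open>Averaging the coefficient vectors of \<open>p\<close> and \<open>q\<close>
      gives the logarithm of their geometric mean.\<close>
    define g where "g = (\<lambda>j. ((1/2) *\<^sub>R (c + c')) \<bullet> column A j)"
    have g: "g j = (ln (p j) + ln (q j)) / 2" if "j < r" for j
      using that by (simp add: g_def c c' inner_add_left)
    define Z where "Z = (\<Sum>j<r. exp (g j))"
    let ?m = "\<lambda>j\<in>{..<r}. exp (g j) / Z"
    have m: "?m \<in> log_linear_model r A"
      using log_linear_model_normalize[OF ones, where c = "(1/2) *\<^sub>R (c + c')"] k(1)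
      by (simp add: g_def Z_def)
    have sq: "exp (g j) = sqrt (p j) * sqrt (q j)" if "j < r" for j
    proof -
      have "exp (g j) = exp (ln (p j) / 2) * exp (ln (q j) / 2)"
        by (simp add: g[OF that] add_divide_distrib exp_add)
      also have "\<dots> = sqrt (p j) * sqrt (q j)"
        using pD(1)[OF that] qD(1)[OF that] by (simp add: powr_half_sqrt[symmetric] powr_def)
      finally show ?thesis .
    qed
    \<comment> \<open>The inequality of arithmetic and geometric means with its exact defect, which
      is positive at \<open>k\<close>; summation then gives \<open>Z < 1\<close>.\<close>
    have am: "exp (g j) = (p j + q j) / 2 - (sqrt (p j) - sqrt (q j))\<^sup>2 / 2" if "j < r" for j
      using pD(1)[OF that] qD(1)[OF that] by (simp add: sq[OF that] power2_diff field_simps)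
    have "Z < (\<Sum>j<r. (p j + q j) / 2)"
      unfolding Z_def
    proof (rule sum_strict_mono_ex1)
      show "\<forall>j\<in>{..<r}. exp (g j) \<le> (p j + q j) / 2"
      proof
        fix j assume "j \<in> {..<r}"
        then have "j < r" by simp
        show "exp (g j) \<le> (p j + q j) / 2"
          using am[OF \<open>j < r\<close>] zero_le_power2[of "sqrt (p j) - sqrt (q j)"] by linarith
      qed
      have "(sqrt (p k) - sqrt (q k))\<^sup>2 / 2 > 0" using k by simp
      then have "exp (g k) < (p k + q k) / 2"
        unfolding am[OF k(1)] by linarith
      then show "\<exists>j\<in>{..<r}. exp (g j) < (p j + q j) / 2"
        using k(1) by blast
    qed simp
    also have "\<dots> = 1"
      using pD(2) qD(2) by (simp add: sum.distrib flip: sum_divide_distrib)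
    finally have "Z < 1" .
    have "Z > 0" unfolding Z_def using k(1) by (intro sum_pos) auto
    \<comment> \<open>Normalization shifts the common log-likelihood of \<open>p\<close> and
      \<open>q\<close> by minus \<open>ln Z\<close> times the total of \<open>u\<close>, a strict
      gain because \<open>0 < Z < 1\<close>.\<close>
    have "(\<Sum>j<r. u j * ln (?m j)) = (\<Sum>j<r. u j * ((ln (p j) + ln (q j)) / 2 - ln Z))"
      using \<open>Z > 0\<close> by (intro sum.cong) (auto simp: ln_div g)
    also have "\<dots> = ((\<Sum>j<r. u j * ln (p j)) + (\<Sum>j<r. u j * ln (q j))) / 2 - (\<Sum>j<r. u j) * ln Z"
      by (simp add: sum.distrib sum_subtractf sum_distrib_left sum_distrib_right algebra_simps
          add_divide_distrib sum_divide_distrib)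
    also have "(\<Sum>j<r. u j * ln (q j)) = (\<Sum>j<r. u j * ln (p j))"
      using eq pD(1) qD(1) by (simp add: likelihood_eq_exp)
    finally have "(\<Sum>j<r. u j * ln (?m j)) = (\<Sum>j<r. u j * ln (p j)) - (\<Sum>j<r. u j) * ln Z"
      by simp
    moreover have "(\<Sum>j<r. u j) * ln Z < 0"
      using u k(1) \<open>0 < Z\<close> \<open>Z < 1\<close> by (intro mult_pos_neg sum_pos) auto
    ultimately have "likelihood r u p < likelihood r u ?m"
      using pD(1) \<open>Z > 0\<close> by (subst (1 2) likelihood_eq_exp) auto
    with max[OF m] show False by simp
  qed
  with p show ?thesis by (auto simp: is_mle_def)
qed

text \<open>
  The row space is closed. Projecting the limit \<open>v\<close> to the row space by solving the normal
  equations leaves a residue that is orthogonal to the row space and a limit of its points.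
\<close>

lemma row_functional_limit:
  fixes a :: "nat \<Rightarrow> 'a::euclidean_space" and F :: "'b filter"
  assumes "F \<noteq> bot" and lim: "\<And>j. j < s \<Longrightarrow> ((\<lambda>x. V x j) \<longlongrightarrow> v j) F"
    and ev: "eventually (\<lambda>x. \<exists>c. \<forall>j<s. V x j = c \<bullet> a j) F"
  shows "\<exists>c. \<forall>j<s. v j = c \<bullet> a j"
proof -
  \<comment> \<open>The Gram operator of the normal equations. Its range is a subspace of a
    finite-dimensional space, hence closed, so the limit equation is solvable.\<close>
  define G where "G = (\<lambda>c. \<Sum>j<s. (c \<bullet> a j) *\<^sub>R a j)"
  have "linear G"
    unfolding G_def by (intro linearI)
      (simp_all add: inner_add_left scaleR_add_left sum.distrib scaleR_sum_right)
  then have "closed (range G)"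
    by (intro closed_subspace linear_subspace_image) auto
  moreover have "((\<lambda>x. \<Sum>j<s. V x j *\<^sub>R a j) \<longlongrightarrow> (\<Sum>j<s. v j *\<^sub>R a j)) F"
    by (intro tendsto_intros lim) auto
  moreover have "eventually (\<lambda>x. (\<Sum>j<s. V x j *\<^sub>R a j) \<in> range G) F"
    using ev
  proof eventually_elim
    case (elim x)
    then obtain c where "\<forall>j<s. V x j = c \<bullet> a j" by blast
    then have "(\<Sum>j<s. V x j *\<^sub>R a j) = G c" by (simp add: G_def)
    then show ?case by simp
  qed
  ultimately have "(\<Sum>j<s. v j *\<^sub>R a j) \<in> range G"
    using Lim_in_closed_set[OF _ _ assms(1)] by auto
  then obtain c where c: "(\<Sum>j<s. v j *\<^sub>R a j) = G c" by (rule rangeE)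
  define w where "w j = v j - c \<bullet> a j" for j
  have w: "(\<Sum>j<s. w j *\<^sub>R a j) = 0"
    using c by (simp add: w_def G_def scaleR_diff_left sum_subtractf)
  \<comment> \<open>The pairing with the residue \<open>w\<close> vanishes before the limit by
    orthogonality, and its limit is the sum of the squares of \<open>w\<close>.\<close>
  have "((\<lambda>x. \<Sum>j<s. w j * (V x j - c \<bullet> a j)) \<longlongrightarrow> (\<Sum>j<s. w j * (v j - c \<bullet> a j))) F"
    by (intro tendsto_intros lim) auto
  moreover have "eventually (\<lambda>x. (\<Sum>j<s. w j * (V x j - c \<bullet> a j)) = 0) F"
    using ev
  proof eventually_elim
    case (elim x)
    then obtain c' where "\<forall>j<s. V x j = c' \<bullet> a j" by blast
    then have "(\<Sum>j<s. w j * (V x j - c \<bullet> a j)) = (c' - c) \<bullet> (\<Sum>j<s. w j *\<^sub>R a j)"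
      by (simp add: inner_diff_left inner_sum_right)
    then show ?case by (simp add: w)
  qed
  ultimately have "((\<lambda>x. 0) \<longlongrightarrow> (\<Sum>j<s. w j * w j)) F"
    unfolding w_def by (rule Lim_transform_eventually)
  then have "(\<Sum>j<s. w j * w j) = 0"
    using tendsto_unique[OF assms(1)] tendsto_const by metis
  then have "\<forall>j<s. w j = 0"
    by (simp add: sum_nonneg_eq_0_iff)
  then show ?thesis by (auto simp: w_def)
qed

section \<open>Approximating the model of a face by the big model\<close>

text \<open>Faces of a polyhedron are exposed. Subtracting \<open>b\<close> times \<open>e\<close>
  from the normal vector of a supporting hyperplane makes its equation homogeneous on the
  columns.\<close>

lemma facial_submatrix_exposing_functional:
  assumes ones: "\<And>j. j < r \<Longrightarrow> e \<bullet> column A j = 1" and "facial_submatrix r A J"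
  obtains f where "\<And>j. j \<in> J \<Longrightarrow> f \<bullet> column A j = 0"
    and "\<And>j. j < r \<Longrightarrow> j \<notin> J \<Longrightarrow> f \<bullet> column A j < 0"
proof -
  let ?P = "column_polytope A {..<r}" and ?Q = "column_polytope A J"
  have "polyhedron ?P"
    unfolding column_polytope_def
    by (intro polytope_imp_polyhedron polytope_convex_hull) auto
  moreover have "?Q face_of ?P" and J: "J = {j. j < r \<and> column A j \<in> ?Q}"
    using assms(2) by (auto simp: facial_submatrix_def)
  ultimately have "?Q exposed_face_of ?P"
    by (simp add: exposed_face_of_polyhedron)
  then obtain a b where ab: "?P \<subseteq> {x. a \<bullet> x \<le> b}" "?Q = ?P \<inter> {x. a \<bullet> x = b}"
    by (auto simp: exposed_face_of_def)
  have P: "column A j \<in> ?P" if "j < r" for j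
    using that by (auto simp: column_polytope_def intro: hull_inc)
  have f: "(a - b *\<^sub>R e) \<bullet> column A j = a \<bullet> column A j - b" if "j < r" for j
    using ones[OF that] by (simp add: inner_diff_left)
  show thesis
  proof (rule that[of "a - b *\<^sub>R e"])
    fix j assume "j \<in> J"
    then have "j < r" "column A j \<in> ?Q" using J by auto
    then show "(a - b *\<^sub>R e) \<bullet> column A j = 0" using f ab(2) by auto
  next
    fix j assume "j < r" "j \<notin> J"
    then have "column A j \<notin> ?Q" using J by blast
    with ab P[OF \<open>j < r\<close>] have "a \<bullet> column A j \<le> b" "a \<bullet> column A j \<noteq> b" by auto
    with f[OF \<open>j < r\<close>] show "(a - b *\<^sub>R e) \<bullet> column A j < 0" by simp
  qed
qed

text \<open>Adding \<open>t\<close> times the exposing functional to the exponent fixes the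
  unnormalized coordinates on the face and sends the others to 0. The normalizing constant therefore
  tends to the mass of \<open>q\<close>, which is 1.\<close>

lemma face_model_approximation:
  assumes ones: "\<And>j. j < r \<Longrightarrow> e \<bullet> column A j = 1"
    and "facial_submatrix r A {..<s}" "s \<le> r" "s > 0"
    and q: "q \<in> log_linear_model s A"
  obtains p :: "real \<Rightarrow> nat \<Rightarrow> real" where "\<And>t. p t \<in> log_linear_model r A"
    and "\<And>j. j < s \<Longrightarrow> ((\<lambda>t. p t j) \<longlongrightarrow> q j) at_top"
proof -
  obtain f where f0: "\<And>j. j < s \<Longrightarrow> f \<bullet> column A j = 0"
    and f1: "\<And>j. j < r \<Longrightarrow> \<not> j < s \<Longrightarrow> f \<bullet> column A j < 0"
    using facial_submatrix_exposing_functional[OF ones assms(2)] by (metis lessThan_iff)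
  from q obtain c where c: "\<And>j. j < s \<Longrightarrow> ln (q j) = c \<bullet> column A j"
    and qs: "q \<in> open_simplex s" by (auto simp: log_linear_model_iff)
  have exp_c: "exp (c \<bullet> column A j) = q j" if "j < s" for j
    using open_simplexD(1)[OF qs that] c[OF that] by (metis exp_ln)
  define g where "g = (\<lambda>t j. exp ((c + t *\<^sub>R f) \<bullet> column A j))"
  \<comment> \<open>The limit of the unnormalized points: \<open>q\<close> extended by zero off the
    face.\<close>
  define l where "l j = (if j < s then q j else 0)" for j
  have lim: "((\<lambda>t. g t j) \<longlongrightarrow> l j) at_top" if "j < r" for j
  proof (cases "j < s")
    case True
    then have "g t j = l j" for t
      by (simp add: g_def l_def inner_add_left f0 exp_c)
    then show ?thesis by simp
  next
    case False
    then have "f \<bullet> column A j < 0" using f1 that by simp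
    then have "filterlim (\<lambda>t. f \<bullet> column A j * t) at_bot at_top"
      by (intro filterlim_tendsto_neg_mult_at_bot[OF tendsto_const] filterlim_ident)
    then have "((\<lambda>t. exp (f \<bullet> column A j * t)) \<longlongrightarrow> 0) at_top"
      by (rule filterlim_compose[OF exp_at_bot])
    then have "((\<lambda>t. exp (c \<bullet> column A j) * exp (f \<bullet> column A j * t)) \<longlongrightarrow> 0) at_top"
      by (rule tendsto_mult_right_zero)
    with False show ?thesis by (simp add: g_def l_def inner_add_left exp_add mult.commute)
  qed
  have "(\<Sum>j<r. l j) = (\<Sum>j<s. q j)"
    unfolding l_def using \<open>s \<le> r\<close>
    by (intro sum.mono_neutral_cong_right) auto
  also have "\<dots> = 1" by (rule open_simplexD(2)[OF qs])
  finally have l1: "(\<Sum>j<r. l j) = 1" .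
  have "((\<lambda>t. g t j / (\<Sum>k<r. g t k)) \<longlongrightarrow> l j / (\<Sum>k<r. l k)) at_top" if "j < s" for j
    using that \<open>s \<le> r\<close> l1 by (intro tendsto_divide tendsto_sum lim) auto
  then have "((\<lambda>t. g t j / (\<Sum>k<r. g t k)) \<longlongrightarrow> q j) at_top" if "j < s" for j
    using that unfolding l1 by (simp add: l_def)
  moreover have "(\<lambda>j\<in>{..<r}. g t j / (\<Sum>k<r. g t k)) \<in> log_linear_model r A" for t
    unfolding g_def using \<open>s \<le> r\<close> \<open>s > 0\<close> by (intro log_linear_model_normalize[OF ones]) auto
  ultimately show thesis
    using \<open>s \<le> r\<close> by (intro that[of "\<lambda>t. \<lambda>j\<in>{..<r}. g t j / (\<Sum>k<r. g t k)"]) auto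
qed

subsection \<open>The limit of the estimator at the face\<close>

text \<open>Exponents may be negative, so a factor is continuous only where its linear form is
  nonzero. This is required exactly for the forms with nonzero exponent in coordinate
  \<open>k\<close>; the other factors are constantly 1, even if their forms tend to 0.\<close>

lemma horn_map_tendsto_face:
  fixes w :: "nat \<Rightarrow> real"
  assumes "s \<le> r" "k < s"
    and nz: "\<And>i. i < d \<Longrightarrow> B i k \<noteq> 0 \<Longrightarrow> (\<Sum>j<s. real_of_int (B i j) * u j) \<noteq> 0"
  shows "((\<lambda>\<epsilon>. horn_map d r B h (\<lambda>j\<in>{..<r}. if j < s then u j else \<epsilon> * w j) k)
      \<longlongrightarrow> horn_map d s B h u k) (at_right 0)"
    and "h k \<noteq> 0 \<Longrightarrow> horn_map d s B h u k \<noteq> 0"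
proof -
  have nz': "(\<Sum>j<s. of_int (B i j) * complex_of_real (u j)) \<noteq> 0" if "i < d" "B i k \<noteq> 0" for i
  proof -
    have "(\<Sum>j<s. of_int (B i j) * complex_of_real (u j))
        = complex_of_real (\<Sum>j<s. real_of_int (B i j) * u j)" by simp
    with nz[OF that] show ?thesis by (metis of_real_eq_0_iff)
  qed
  let ?u = "\<lambda>\<epsilon>. \<lambda>j\<in>{..<r}. if j < s then u j else \<epsilon> * w j"
  let ?L = "\<lambda>i \<epsilon>. \<Sum>j<r. of_int (B i j) * complex_of_real (?u \<epsilon> j)"
  have lim: "(?L i \<longlongrightarrow> (\<Sum>j<s. of_int (B i j) * complex_of_real (u j))) (at_right 0)" for i
  proof -
    have "((\<lambda>\<epsilon>. ?u \<epsilon> j) \<longlongrightarrow> (if j < s then u j else 0 * w j)) (at_right 0)" if "j < r" for j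
      using that by (cases "j < s") (auto intro!: tendsto_eq_intros)
    then have "(?L i \<longlongrightarrow> (\<Sum>j<r. of_int (B i j) *
        complex_of_real (if j < s then u j else 0 * w j))) (at_right 0)"
      by (intro tendsto_sum tendsto_mult tendsto_const tendsto_of_real) auto
    also have "(\<Sum>j<r. of_int (B i j) * complex_of_real (if j < s then u j else 0 * w j))
        = (\<Sum>j<s. of_int (B i j) * complex_of_real (u j))"
      using \<open>s \<le> r\<close> by (intro sum.mono_neutral_cong_right) auto
    finally show ?thesis .
  qed
  have "((\<lambda>\<epsilon>. ?L i \<epsilon> powi B i k) \<longlongrightarrow>
      (\<Sum>j<s. of_int (B i j) * complex_of_real (u j)) powi B i k) (at_right 0)" if "i < d" for i
    using lim[of i] nz'[OF that] by (cases "B i k = 0") (auto intro!: tendsto_power_int)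
  then show "((\<lambda>\<epsilon>. horn_map d r B h (?u \<epsilon>) k) \<longlongrightarrow> horn_map d s B h u k) (at_right 0)"
    unfolding horn_map_def by (intro tendsto_mult tendsto_const tendsto_prod) auto
  show "horn_map d s B h u k \<noteq> 0" if "h k \<noteq> 0"
    using that nz' by (auto simp: horn_map_def power_int_eq_0_iff)
qed

text \<open>Independent of Horn maps: the estimates enter only through their coordinatewise
  convergence on the face to nonzero limits.\<close>

lemma mle_limit_face:
  fixes A :: "'n::finite \<Rightarrow> nat \<Rightarrow> int"
  assumes ones: "\<And>j. j < r \<Longrightarrow> e \<bullet> column A j = 1"
    and face: "facial_submatrix r A {..<s}" and sr: "s \<le> r" "s > 0"
    and u: "\<And>j. j < s \<Longrightarrow> u j > 0"
    and w: "\<And>j. w j \<ge> 0"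
    and mle: "eventually (\<lambda>\<epsilon>. is_mle r (log_linear_model r A)
      (\<lambda>j\<in>{..<r}. if j < s then u j else \<epsilon> * w j) (P \<epsilon>)) (at_right 0)"
    and lim: "\<And>j. j < s \<Longrightarrow> ((\<lambda>\<epsilon>. P \<epsilon> j) \<longlongrightarrow> \<psi> j) (at_right 0)"
    and \<psi>0: "\<And>j. j < s \<Longrightarrow> \<psi> j \<noteq> 0"
  shows "is_mle s (log_linear_model s A) u (\<lambda>j\<in>{..<s}. \<psi> j)"
proof -
  let ?u = "\<lambda>\<epsilon>. \<lambda>j\<in>{..<r}. if j < s then u j else \<epsilon> * w j"
  have ones_s: "\<And>j. j < s \<Longrightarrow> e \<bullet> column A j = 1" using ones sr by auto
  have Psim: "eventually (\<lambda>\<epsilon>. P \<epsilon> \<in> open_simplex r) (at_right 0)"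
    using mle by eventually_elim (simp add: is_mle_def log_linear_model_iff)
  have \<psi>pos: "\<psi> j > 0" if "j < s" for j
  proof -
    have "eventually (\<lambda>\<epsilon>. P \<epsilon> j \<ge> 0) (at_right 0)"
      using Psim by eventually_elim (use that sr open_simplexD(1) in \<open>force intro: less_imp_le\<close>)
    then have "\<psi> j \<ge> 0"
      by (intro tendsto_lowerbound[OF lim[OF that]]) auto
    with \<psi>0[OF that] show ?thesis by simp
  qed
  have "eventually (\<lambda>\<epsilon>. (\<Sum>j<s. P \<epsilon> j) \<le> 1) (at_right 0)"
    using Psim
  proof eventually_elim
    case (elim \<epsilon>)
    have "(\<Sum>j<s. P \<epsilon> j) \<le> (\<Sum>j<r. P \<epsilon> j)"
      using sr open_simplexD(1)[OF elim] by (intro sum_mono2) (auto intro: less_imp_le)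
    then show ?case using open_simplexD(2)[OF elim] by simp
  qed
  then have mass_le: "(\<Sum>j<s. \<psi> j) \<le> 1"
    by (intro tendsto_upperbound[OF tendsto_sum[OF lim]]) auto
  \<comment> \<open>A row functional of the big matrix restricts to one of the face, and the row
    space of the face is closed. The logarithms converge because the limits are nonzero.\<close>
  have "eventually (\<lambda>\<epsilon>. \<exists>c. \<forall>j<s. ln (P \<epsilon> j) = c \<bullet> column A j) (at_right 0)"
    using mle by eventually_elim (use sr in \<open>force simp: is_mle_def log_linear_model_iff\<close>)
  moreover have lim_ln: "((\<lambda>\<epsilon>. ln (P \<epsilon> j)) \<longlongrightarrow> ln (\<psi> j)) (at_right 0)" if "j < s" for j
    using lim[OF that] \<psi>0[OF that] by (rule tendsto_ln)
  ultimately obtain c where c: "\<And>j. j < s \<Longrightarrow> ln (\<psi> j) = c \<bullet> column A j"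
    using row_functional_limit[of "at_right (0::real)" s "\<lambda>\<epsilon> j. ln (P \<epsilon> j)"
        "\<lambda>j. ln (\<psi> j)" "column A"] by auto
  have le_r: "(\<Sum>j<s. u j * ln (p j)) \<le> (\<Sum>j<s. u j * ln (\<psi> j))"
    if p: "p \<in> log_linear_model r A" for p
  proof -
    have ps: "p \<in> open_simplex r" using p by (simp add: log_linear_model_iff)
    have "eventually (\<lambda>\<epsilon>. (\<Sum>j<r. ?u \<epsilon> j * ln (p j)) \<le> (\<Sum>j<s. u j * ln (P \<epsilon> j))) (at_right 0)"
      using mle Psim eventually_at_right_less[of 0]
    proof eventually_elim
      case (elim \<epsilon>)
      have "likelihood r (?u \<epsilon>) p \<le> likelihood r (?u \<epsilon>) (P \<epsilon>)"
        using elim(1) p unfolding is_mle_def by (cases "p = P \<epsilon>") (auto intro: less_imp_le)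
      then have "(\<Sum>j<r. ?u \<epsilon> j * ln (p j)) \<le> (\<Sum>j<r. ?u \<epsilon> j * ln (P \<epsilon> j))"
        using open_simplexD(1)[OF ps] open_simplexD(1)[OF elim(2)]
        by (subst (asm) (1 2) likelihood_eq_exp) auto
      also have "\<dots> = (\<Sum>j<s. ?u \<epsilon> j * ln (P \<epsilon> j)) + (\<Sum>j\<in>{s..<r}. ?u \<epsilon> j * ln (P \<epsilon> j))"
        using sr by (subst sum.union_disjoint[symmetric])
          (auto intro!: sum.cong simp: ivl_disj_un)
      \<comment> \<open>Each term is a nonnegative weight times the logarithm of a
        probability.\<close>
      also have "(\<Sum>j\<in>{s..<r}. ?u \<epsilon> j * ln (P \<epsilon> j)) \<le> 0"
        using w elim(3) open_simplexD(1)[OF elim(2)] open_simplex_le_1[OF elim(2)]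
        by (intro sum_nonpos mult_nonneg_nonpos) auto
      also have "(\<Sum>j<s. ?u \<epsilon> j * ln (P \<epsilon> j)) = (\<Sum>j<s. u j * ln (P \<epsilon> j))"
        using sr by (intro sum.cong) auto
      finally show ?case by simp
    qed
    moreover have "((\<lambda>\<epsilon>. \<Sum>j<s. u j * ln (P \<epsilon> j)) \<longlongrightarrow> (\<Sum>j<s. u j * ln (\<psi> j))) (at_right 0)"
      by (intro tendsto_intros lim_ln) auto
    moreover have "((\<lambda>\<epsilon>. \<Sum>j<r. ?u \<epsilon> j * ln (p j)) \<longlongrightarrow> (\<Sum>j<s. u j * ln (p j))) (at_right 0)"
    proof -
      have "((\<lambda>\<epsilon>. ?u \<epsilon> j) \<longlongrightarrow> (if j < s then u j else 0 * w j)) (at_right 0)" if "j < r" for j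
        using that by (cases "j < s") (auto intro!: tendsto_eq_intros)
      then have "((\<lambda>\<epsilon>. \<Sum>j<r. ?u \<epsilon> j * ln (p j)) \<longlongrightarrow>
          (\<Sum>j<r. (if j < s then u j else 0 * w j) * ln (p j))) (at_right 0)"
        by (intro tendsto_sum tendsto_mult tendsto_const) auto
      also have "(\<Sum>j<r. (if j < s then u j else 0 * w j) * ln (p j)) = (\<Sum>j<s. u j * ln (p j))"
        using sr by (intro sum.mono_neutral_cong_right) auto
      finally show ?thesis .
    qed
    ultimately show ?thesis
      by (intro tendsto_le[of "at_right (0::real)"]) auto
  qed
  \<comment> \<open>Only the first \<open>s\<close> coordinates occur in \<open>le_r\<close>, so the
    bound passes to limits of points of the big model.\<close>
  have le_s: "(\<Sum>j<s. u j * ln (q j)) \<le> (\<Sum>j<s. u j * ln (\<psi> j))"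
    if q: "q \<in> log_linear_model s A" for q
  proof -
    have qs: "q \<in> open_simplex s" using q by (simp add: log_linear_model_iff)
    obtain p :: "real \<Rightarrow> nat \<Rightarrow> real" where p: "\<And>t. p t \<in> log_linear_model r A"
      and plim: "\<And>j. j < s \<Longrightarrow> ((\<lambda>t. p t j) \<longlongrightarrow> q j) at_top"
      using face_model_approximation[OF ones face sr q] by blast
    have "((\<lambda>t. \<Sum>j<s. u j * ln (p t j)) \<longlongrightarrow> (\<Sum>j<s. u j * ln (q j))) at_top"
      using open_simplexD(1)[OF qs] by (intro tendsto_intros tendsto_ln plim) force+
    then show ?thesis
      by (rule tendsto_upperbound) (auto intro!: always_eventually le_r p)
  qed
  define \<sigma> where "\<sigma> = (\<Sum>j<s. \<psi> j)"
  have "\<sigma> > 0" unfolding \<sigma>_def using \<psi>pos sr by (intro sum_pos) auto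
  have exp_c: "exp (c \<bullet> column A j) = \<psi> j" if "j < s" for j
    using \<psi>pos[OF that] c[OF that] by (metis exp_ln)
  have norm: "(\<lambda>j\<in>{..<s}. \<psi> j / \<sigma>) \<in> log_linear_model s A"
  proof -
    have "(\<lambda>j\<in>{..<s}. \<psi> j / \<sigma>)
        = (\<lambda>j\<in>{..<s}. exp (c \<bullet> column A j) / (\<Sum>k<s. exp (c \<bullet> column A k)))"
      by (auto simp: \<sigma>_def exp_c)
    then show ?thesis using log_linear_model_normalize[OF ones_s sr(2)] by simp
  qed
  \<comment> \<open>Rescaling costs \<open>ln \<sigma>\<close> times the total of \<open>u\<close>.
    Since the rescaled point cannot beat \<open>\<psi>\<close>, this cost is nonnegative, hence
    \<open>\<sigma> \<ge> 1\<close>.\<close>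
  have "(\<Sum>j<s. u j * ln ((\<lambda>j\<in>{..<s}. \<psi> j / \<sigma>) j)) = (\<Sum>j<s. u j * ln (\<psi> j) - u j * ln \<sigma>)"
    using \<psi>0 \<open>\<sigma> > 0\<close> by (intro sum.cong) (auto simp: ln_div algebra_simps)
  with le_s[OF norm] have "(\<Sum>j<s. u j) * ln \<sigma> \<ge> 0"
    by (simp add: sum_subtractf sum_distrib_right)
  moreover have "(\<Sum>j<s. u j) > 0" using u sr by (intro sum_pos) auto
  ultimately have "\<sigma> \<ge> 1"
    using \<open>\<sigma> > 0\<close> by (simp add: zero_le_mult_iff)
  with mass_le have "\<sigma> = 1" by (simp add: \<sigma>_def)
  with norm have mem: "(\<lambda>j\<in>{..<s}. \<psi> j) \<in> log_linear_model s A" by simp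
  show ?thesis
  proof (rule is_mle_if_maximal[OF ones_s u mem])
    fix q assume q: "q \<in> log_linear_model s A"
    then have "q \<in> open_simplex s" by (simp add: log_linear_model_iff)
    then show "likelihood s u q \<le> likelihood s u (\<lambda>j\<in>{..<s}. \<psi> j)"
      using le_s[OF q] \<psi>pos open_simplexD(1) by (subst (1 2) likelihood_eq_exp) auto
  qed
qed

section \<open>Generic data on the face and transfer of the Horn pair\<close>

theorem theorem3p2:
  fixes A :: "'n::finite \<Rightarrow> nat \<Rightarrow> int"
    and B :: "nat \<Rightarrow> nat \<Rightarrow> int"
    and h :: "nat \<Rightarrow> complex"
    and r s d :: nat
  assumes "(\<lambda>j\<in>{..<r}. 1) \<in> rowspan r A"
    and "lattice_distance_matrix r A"
    and "s \<le> r"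
    and "facial_submatrix r A {..<s}"
    and "mle_given_by_horn_pair r (log_linear_model r A) d B h"
  shows "mle_given_by_horn_pair s (log_linear_model s A) d B h"
proof -
  obtain e where ones: "\<And>j. j < r \<Longrightarrow> e \<bullet> column A j = 1"
    using assms(1) unfolding rowspan_iff by metis
  have "s > 0"
    using assms(4) by (auto simp: facial_submatrix_def column_polytope_def)
  have horn: "horn_pair d r B h"
    using assms(5) by (simp add: mle_given_by_horn_pair_def)
  obtain f x where f: "polynomial_fun r f" "f x \<noteq> 0"
    and generic: "\<And>u. u \<in> {..<r} \<rightarrow>\<^sub>E {0..} \<Longrightarrow> f u \<noteq> 0 \<Longrightarrow>
      \<exists>p. is_mle r (log_linear_model r A) u p \<and>
        (\<forall>k<r. complex_of_real (p k) = horn_map d r B h u k)"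
    using assms(5) unfolding mle_given_by_horn_pair_def generic_data_def by blast
  \<comment> \<open>Nonnegativity of \<open>w\<close> keeps the perturbed data in the orthant, where
    the genericity hypothesis applies.\<close>
  obtain w where w: "f w \<noteq> 0" "\<And>j. w j \<ge> 0"
    using polynomial_fun_nonzero_nonneg[OF f] by blast
  \<comment> \<open>The rows whose linear form is not identically zero on the face. All other rows
    have exponent 0 in every coordinate \<open>k < s\<close>.\<close>
  define I where "I = {i. i < d \<and> (\<exists>k<s. B i k \<noteq> 0)}"
  \<comment> \<open>Three conditions on face data: \<open>?f\<close> gives generic perturbations,
    \<open>?c\<close> turns nonnegative data into positive data, and \<open>?l\<close> keeps the
    relevant linear forms nonzero.\<close>
  let ?f = "\<lambda>u. f (\<lambda>j. if j < s then u j else w j)"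
  let ?c = "\<lambda>u. \<Prod>j<s. (u :: nat \<Rightarrow> real) j"
  let ?l = "\<lambda>u. \<Prod>i\<in>I. \<Sum>j<s. real_of_int (B i j) * u j"
  have pf: "polynomial_fun s ?f" and "?f w \<noteq> 0"
    using polynomial_fun_fix_coords[OF f(1)] w(1) by auto
  have "polynomial_fun s ?c \<and> (\<exists>x. ?c x \<noteq> 0)"
    by (rule polynomial_fun_nonzero_prod)
      (auto intro: polynomial_fun.coord exI[of _ "\<lambda>_. 1"])
  then have c: "polynomial_fun s ?c" "\<exists>x. ?c x \<noteq> 0" by blast+
  have l: "polynomial_fun s ?l" "\<exists>x. ?l x \<noteq> 0"
  proof -
    have "polynomial_fun s (\<lambda>u. \<Sum>j<s. real_of_int (B i j) * u j) \<and>
        (\<exists>x. (\<Sum>j<s. real_of_int (B i j) * x j) \<noteq> 0)" if "i \<in> I" for i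
    proof
      show "polynomial_fun s (\<lambda>u. \<Sum>j<s. real_of_int (B i j) * u j)"
        by (intro polynomial_fun_sum) (auto intro: polynomial_fun.intros)
      obtain k where "k < s" "B i k \<noteq> 0" using \<open>i \<in> I\<close> by (auto simp: I_def)
      \<comment> \<open>The unit vector at \<open>k\<close> picks out the coefficient
        \<open>B i k\<close>.\<close>
      then have "(\<Sum>j<s. real_of_int (B i j) * (if j = k then 1 else 0)) \<noteq> 0"
        by (simp add: if_distrib cong: if_cong)
      then show "\<exists>x. (\<Sum>j<s. real_of_int (B i j) * x j) \<noteq> 0"
        by (rule exI[of _ "\<lambda>j. if j = k then 1 else 0"])
    qed
    then show "polynomial_fun s ?l" "\<exists>x. ?l x \<noteq> 0"
      using polynomial_fun_nonzero_prod[of I s "\<lambda>i u. \<Sum>j<s. real_of_int (B i j) * u j"]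
      by (auto simp: I_def)
  qed
  have "\<exists>p. is_mle s (log_linear_model s A) u p \<and>
      (\<forall>k<s. complex_of_real (p k) = horn_map d s B h u k)"
    if u: "u \<in> {..<s} \<rightarrow>\<^sub>E {0..}" and nz: "?f u \<noteq> 0" "?c u \<noteq> 0" "?l u \<noteq> 0" for u
  proof -
    have upos: "u j > 0" if "j < s" for j
      using u nz(2) that by (force simp: PiE_iff order_less_le)
    let ?u = "\<lambda>\<epsilon>. \<lambda>j\<in>{..<r}. if j < s then u j else \<epsilon> * w j"
    \<comment> \<open>The perturbed data lie on a line as far as \<open>f\<close> can see;
      coordinates from \<open>r\<close> on, where \<open>?u\<close> is undefined, do not
      matter.\<close>
    have f_eq: "f (\<lambda>j. (if j < s then u j else 0) + \<epsilon> * (if j < s then 0 else w j)) = f (?u \<epsilon>)" for \<epsilon>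
      by (rule polynomial_fun_cong[OF f(1)]) auto
    \<comment> \<open>The parameter 1 provides the nonzero value on this line, from which
      nonvanishing near 0 follows.\<close>
    have "f (?u 1) = ?f u"
      by (rule polynomial_fun_cong[OF f(1)]) auto
    with nz(1) have "f (?u 1) \<noteq> 0" by simp
    then have "eventually (\<lambda>\<epsilon>. f (?u \<epsilon>) \<noteq> 0) (at_right 0)"
      using polynomial_fun_eventually_nonzero_on_line[OF f(1), of
          "\<lambda>j. if j < s then u j else 0" 1 "\<lambda>j. if j < s then 0 else w j" 0 "{0<..}"]
      unfolding f_eq by blast
    then have ev: "eventually (\<lambda>\<epsilon>. \<exists>p. is_mle r (log_linear_model r A) (?u \<epsilon>) p \<and>
        (\<forall>k<r. complex_of_real (p k) = horn_map d r B h (?u \<epsilon>) k)) (at_right 0)"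
      using eventually_at_right_less[of 0]
    proof eventually_elim
      case (elim \<epsilon>)
      then have "?u \<epsilon> \<in> {..<r} \<rightarrow>\<^sub>E {0..}"
        using less_imp_le[OF upos] w(2) by auto
      with elim show ?case by (intro generic)
    qed
    define P where "P \<epsilon> = (SOME p. is_mle r (log_linear_model r A) (?u \<epsilon>) p \<and>
        (\<forall>k<r. complex_of_real (p k) = horn_map d r B h (?u \<epsilon>) k))" for \<epsilon>
    have P: "eventually (\<lambda>\<epsilon>. is_mle r (log_linear_model r A) (?u \<epsilon>) (P \<epsilon>) \<and>
        (\<forall>k<r. complex_of_real (P \<epsilon> k) = horn_map d r B h (?u \<epsilon>) k)) (at_right 0)"
      using ev unfolding P_def by eventually_elim (drule someI_ex)
    have forms: "(\<Sum>j<s. real_of_int (B i j) * u j) \<noteq> 0" if "i < d" "B i k \<noteq> 0" "k < s" for i k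
      using nz(3) that by (auto simp: I_def)
    have lim: "((\<lambda>\<epsilon>. complex_of_real (P \<epsilon> k)) \<longlongrightarrow> horn_map d s B h u k) (at_right 0)"
      if "k < s" for k
    proof (rule Lim_transform_eventually)
      show "((\<lambda>\<epsilon>. horn_map d r B h (?u \<epsilon>) k) \<longlongrightarrow> horn_map d s B h u k) (at_right 0)"
        using assms(3) that forms by (intro horn_map_tendsto_face(1)) auto
      show "eventually (\<lambda>\<epsilon>. horn_map d r B h (?u \<epsilon>) k = complex_of_real (P \<epsilon> k)) (at_right 0)"
        using P by eventually_elim (use that assms(3) in auto)
    qed
    \<comment> \<open>Taking real parts loses nothing: the truncated Horn map is a limit of real
      estimates, and the reals are closed in the complex numbers.\<close>
    define \<psi> where "\<psi> k = Re (horn_map d s B h u k)" for k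
    have real: "complex_of_real (\<psi> k) = horn_map d s B h u k" if "k < s" for k
    proof -
      have "horn_map d s B h u k \<in> \<real>"
        by (rule Lim_in_closed_set[OF closed_complex_Reals _ _ lim[OF that]]) auto
      then show ?thesis by (simp add: \<psi>_def)
    qed
    have "is_mle s (log_linear_model s A) u (\<lambda>j\<in>{..<s}. \<psi> j)"
    proof (rule mle_limit_face[OF ones assms(4,3) \<open>s > 0\<close> upos w(2)])
      show "eventually (\<lambda>\<epsilon>. is_mle r (log_linear_model r A) (?u \<epsilon>) (P \<epsilon>)) (at_right 0)"
        using P by eventually_elim simp
      fix j assume j: "j < s"
      show "((\<lambda>\<epsilon>. P \<epsilon> j) \<longlongrightarrow> \<psi> j) (at_right 0)"
        using tendsto_Re[OF lim[OF j]] by (simp add: \<psi>_def)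
      \<comment> \<open>The nonvanishing claim does not mention the larger number of columns, so the
        lemma is instantiated with \<open>s\<close> for both.\<close>
      have "horn_map d s B h u j \<noteq> 0"
        using horn assms(3) j forms
        by (intro horn_map_tendsto_face(2)[of s s]) (auto simp: horn_pair_def)
      then show "\<psi> j \<noteq> 0" using real[OF j] by auto
    qed
    with real show ?thesis by (intro exI[of _ "\<lambda>j\<in>{..<s}. \<psi> j"]) auto
  qed
  moreover have "\<exists>x. ?f x * (?c x * ?l x) \<noteq> 0"
  proof -
    obtain y where "?c y * ?l y \<noteq> 0"
      using polynomial_fun_nonzero_mult[OF c(1) _ l(1)] c(2) l(2) by blast
    then show ?thesis
      using polynomial_fun_nonzero_mult[OF pf \<open>?f w \<noteq> 0\<close> polynomial_fun.mult[OF c(1) l(1)]]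
      by blast
  qed
  ultimately have "generic_data s (\<lambda>u. \<exists>p. is_mle s (log_linear_model s A) u p \<and>
      (\<forall>k<s. complex_of_real (p k) = horn_map d s B h u k))"
    unfolding generic_data_def
    using polynomial_fun.mult[OF pf polynomial_fun.mult[OF c(1) l(1)]]
    by (intro exI[of _ "\<lambda>u. ?f u * (?c u * ?l u)"]) auto
  moreover have "horn_pair d s B h"
    using horn assms(3) by (auto simp: horn_pair_def)
  ultimately show ?thesis by (simp add: mle_given_by_horn_pair_def)
qed

end
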